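(* Let $S$ be a semiring and let $T$ be a multiplicatively closed subset of $S$. (1) If $I$ is a $k$-strongly irreducible and a $k$-primary ideal of $S$ which does not meet $T$, then $T^{-1}I$ is a $k$-strongly irreducible (and a $k$-primary) ideal of $T^{-1}S$. (2) If $S$ is a subtractive unique factorisation semidomain or a von Neumann regular semiring, then there is a one-to-one correspondence between the $k$-strongly irreducible ideals of $T^{-1}S$ and the $k$-strongly irreducible ideals of $S$ which do not meet $T$.
   Context: A semiring is a commutative semiring $(S,+,0,\cdot,1)$ with multiplicative identity $1$ and additive identity $0$ that is multiplicatively absorbing. An ideal is a nonempty subset closed under addition and under multiplication by elements of $S$. A $k$-ideal is an ideal $I$ such that $x+y\in I$ and $y\in I$ imply $x\in I$. A $k$-ideal $I$ is $k$-strongly irreducible if for all $k$-ideals $A,B$ of the semiring, $A\cap B\subseteq I$ implies $A\subseteq I$ or $B\subseteq I$; it is $k$-primary if $ab\in I$ and $a\notin I$ imply $b^n\in I$ for some natural number $n$. $S$ is subtractive if every ideal of $S$ is a $k$-ideal. $S$ is a semidomain if $ab=ac$ with $a\ne 0$ implies $b=c$. A non-zero non-unit $r$ is irreducible if $r=r_1r_2$ implies that $r_1$ or $r_2$ is a unit; an element $p$ is prime if the principal ideal $\langle p\rangle$ is a prime ideal. A semidomain is a unique factorisation semidomain if every irreducible element is prime and every non-zero non-unit element can be uniquely written as a product of irreducible elements. $S$ is von Neumann regular if for every $a\in S$ there is $x\in S$ with $a=a^2x$. A multiplicatively closed subset contains $1$ and is closed under products. $T^{-1}S$ denotes the localisation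 of $S$ at $T$, that is, the semiring of fractions $x/s$ with $x\in S$, $s\in T$; for an ideal $I$ of $S$, $T^{-1}I=\{x/s : x\in I,\ s\in T\}$.
   Formalization: In (2) only proper k-strongly irreducible ideals of T^{-1}S are counted, since T^{-1}S itself satisfies the definition but matches no ideal of S missing T (e.g. S a field, T={1}); the correspondence is I ↦ T^{-1}I. *)

theory Defs
  imports "HOL-Algebra.Divisibility" "HOL-Algebra.Ideal"
begin

text \<open>
  Carrier-based structures are used (rather than the type class \<open>comm_semiring_1\<close>, which
  imposes \<open>0 \<noteq> 1\<close>) because a multiplicatively closed set may contain zero, in which case the
  localisation is the one-element semiring.
\<close>

locale comm_semiring_one = semiring S + comm_monoid S for S (structure)

subsection \<open>Ideals of semirings\<close>

definition semiring_ideal :: "('a, 'm) ring_scheme \<Rightarrow> 'a set \<Rightarrow> bool" where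
  "semiring_ideal S I \<longleftrightarrow> I \<subseteq> carrier S \<and> I \<noteq> {} \<and>
     (\<forall>x\<in>I. \<forall>y\<in>I. x \<oplus>\<^bsub>S\<^esub> y \<in> I) \<and>
     (\<forall>r\<in>carrier S. \<forall>x\<in>I. r \<otimes>\<^bsub>S\<^esub> x \<in> I)"

definition k_ideal :: "('a, 'm) ring_scheme \<Rightarrow> 'a set \<Rightarrow> bool" where
  "k_ideal S I \<longleftrightarrow> semiring_ideal S I \<and>
     (\<forall>x\<in>carrier S. \<forall>y\<in>carrier S. x \<oplus>\<^bsub>S\<^esub> y \<in> I \<and> y \<in> I \<longrightarrow> x \<in> I)"

text \<open>As defined here, the whole semiring is \<open>k\<close>-strongly irreducible and \<open>k\<close>-primary;
  properness has to be required separately where it matters.\<close>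

definition k_strongly_irreducible :: "('a, 'm) ring_scheme \<Rightarrow> 'a set \<Rightarrow> bool" where
  "k_strongly_irreducible S I \<longleftrightarrow> k_ideal S I \<and>
     (\<forall>A B. k_ideal S A \<longrightarrow> k_ideal S B \<longrightarrow> A \<inter> B \<subseteq> I \<longrightarrow> A \<subseteq> I \<or> B \<subseteq> I)"

definition k_primary :: "('a, 'm) ring_scheme \<Rightarrow> 'a set \<Rightarrow> bool" where
  "k_primary S I \<longleftrightarrow> k_ideal S I \<and>
     (\<forall>a\<in>carrier S. \<forall>b\<in>carrier S.
        a \<otimes>\<^bsub>S\<^esub> b \<in> I \<longrightarrow> a \<notin> I \<longrightarrow> (\<exists>n::nat. n > 0 \<and> b [^]\<^bsub>S\<^esub> n \<in> I))"

definition semiring_prime_ideal :: "('a, 'm) ring_scheme \<Rightarrow> 'a set \<Rightarrow> bool" where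
  "semiring_prime_ideal S P \<longleftrightarrow> semiring_ideal S P \<and> P \<noteq> carrier S \<and>
     (\<forall>a\<in>carrier S. \<forall>b\<in>carrier S. a \<otimes>\<^bsub>S\<^esub> b \<in> P \<longrightarrow> a \<in> P \<or> b \<in> P)"

definition subtractive :: "('a, 'm) ring_scheme \<Rightarrow> bool" where
  "subtractive S \<longleftrightarrow> (\<forall>I. semiring_ideal S I \<longrightarrow> k_ideal S I)"

subsection \<open>Unique factorisation and regularity\<close>

definition semidomain :: "('a, 'm) ring_scheme \<Rightarrow> bool" where
  "semidomain S \<longleftrightarrow> comm_semiring_one S \<and>
     (\<forall>a\<in>carrier S. \<forall>b\<in>carrier S. \<forall>c\<in>carrier S.
        a \<otimes>\<^bsub>S\<^esub> b = a \<otimes>\<^bsub>S\<^esub> c \<longrightarrow> a \<noteq> \<zero>\<^bsub>S\<^esub> \<longrightarrow> b = c)"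

definition semiring_irreducible :: "('a, 'm) ring_scheme \<Rightarrow> 'a \<Rightarrow> bool" where
  "semiring_irreducible S r \<longleftrightarrow> r \<in> carrier S \<and> r \<noteq> \<zero>\<^bsub>S\<^esub> \<and> r \<notin> Units S \<and>
     (\<forall>a\<in>carrier S. \<forall>b\<in>carrier S. r = a \<otimes>\<^bsub>S\<^esub> b \<longrightarrow> a \<in> Units S \<or> b \<in> Units S)"

definition semiring_prime :: "('a, 'm) ring_scheme \<Rightarrow> 'a \<Rightarrow> bool" where
  "semiring_prime S p \<longleftrightarrow> p \<in> carrier S \<and> semiring_prime_ideal S (PIdl\<^bsub>S\<^esub> p)"

definition irreducible_factorisation :: "('a, 'm) ring_scheme \<Rightarrow> 'a list \<Rightarrow> 'a \<Rightarrow> bool" where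
  "irreducible_factorisation S fs a \<longleftrightarrow>
     (\<forall>r\<in>set fs. semiring_irreducible S r) \<and> foldr (\<otimes>\<^bsub>S\<^esub>) fs \<one>\<^bsub>S\<^esub> = a"

text \<open>Uniqueness of factorisations is up to order and associates (\<open>essentially_equal\<close>).\<close>

definition unique_factorisation_semidomain :: "('a, 'm) ring_scheme \<Rightarrow> bool" where
  "unique_factorisation_semidomain S \<longleftrightarrow> semidomain S \<and>
     (\<forall>r. semiring_irreducible S r \<longrightarrow> semiring_prime S r) \<and>
     (\<forall>a\<in>carrier S. a \<noteq> \<zero>\<^bsub>S\<^esub> \<longrightarrow> a \<notin> Units S \<longrightarrow>
        (\<exists>fs. irreducible_factorisation S fs a) \<and>
        (\<forall>fs gs. irreducible_factorisation S fs a \<longrightarrow> irreducible_factorisation S gs a \<longrightarrow>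
           essentially_equal S fs gs))"

definition von_neumann_regular :: "('a, 'm) ring_scheme \<Rightarrow> bool" where
  "von_neumann_regular S \<longleftrightarrow>
     (\<forall>a\<in>carrier S. \<exists>x\<in>carrier S. a = (a \<otimes>\<^bsub>S\<^esub> a) \<otimes>\<^bsub>S\<^esub> x)"

subsection \<open>Localisation\<close>

text \<open>The fraction \<open>x/s\<close> is the class of \<open>(x, s)\<close> under \<open>(x, s) \<sim> (y, t)\<close> iff
  \<open>u x t = u y s\<close> for some \<open>u \<in> T\<close>; the factor \<open>u\<close> is needed as \<open>T\<close> may contain
  non-cancellable elements.\<close>

definition frac_rel :: "('a, 'm) ring_scheme \<Rightarrow> 'a set \<Rightarrow> (('a \<times> 'a) \<times> ('a \<times> 'a)) set" where
  "frac_rel S T = {((x, s), (y, t)). x \<in> carrier S \<and> y \<in> carrier S \<and> s \<in> T \<and> t \<in> T \<and>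
     (\<exists>u\<in>T. u \<otimes>\<^bsub>S\<^esub> (x \<otimes>\<^bsub>S\<^esub> t) = u \<otimes>\<^bsub>S\<^esub> (y \<otimes>\<^bsub>S\<^esub> s))}"

definition frac :: "('a, 'm) ring_scheme \<Rightarrow> 'a set \<Rightarrow> 'a \<Rightarrow> 'a \<Rightarrow> ('a \<times> 'a) set" where
  "frac S T x s = frac_rel S T `` {(x, s)}"

definition localisation :: "('a, 'm) ring_scheme \<Rightarrow> 'a set \<Rightarrow> ('a \<times> 'a) set ring" where
  "localisation S T =
     \<lparr>carrier = {frac S T x s | x s. x \<in> carrier S \<and> s \<in> T},
      monoid.mult = (\<lambda>X Y. \<Union>(x, s)\<in>X. \<Union>(y, t)\<in>Y. frac S T (x \<otimes>\<^bsub>S\<^esub> y) (s \<otimes>\<^bsub>S\<^esub> t)),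
      one = frac S T \<one>\<^bsub>S\<^esub> \<one>\<^bsub>S\<^esub>,
      zero = frac S T \<zero>\<^bsub>S\<^esub> \<one>\<^bsub>S\<^esub>,
      add = (\<lambda>X Y. \<Union>(x, s)\<in>X. \<Union>(y, t)\<in>Y.
               frac S T ((x \<otimes>\<^bsub>S\<^esub> t) \<oplus>\<^bsub>S\<^esub> (y \<otimes>\<^bsub>S\<^esub> s)) (s \<otimes>\<^bsub>S\<^esub> t))\<rparr>"

definition localised_ideal :: "('a, 'm) ring_scheme \<Rightarrow> 'a set \<Rightarrow> 'a set \<Rightarrow> ('a \<times> 'a) set set" where
  "localised_ideal S T I = {frac S T x s | x s. x \<in> I \<and> s \<in> T}"

text \<open>The operations do not depend on the chosen representatives.\<close>

locale localised_semiring = comm_semiring_one S + submonoid T S for S (structure) and T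
begin

lemma T_carrier [simp]: "s \<in> T \<Longrightarrow> s \<in> carrier S"
  using subset by blast

lemma frac_rel_equiv: "equiv (carrier S \<times> T) (frac_rel S T)"
proof (rule equivI)
  show "frac_rel S T \<subseteq> (carrier S \<times> T) \<times> (carrier S \<times> T)"
    by (auto simp: frac_rel_def)
  show "refl_on (carrier S \<times> T) (frac_rel S T)"
    by (auto simp: refl_on_def frac_rel_def intro: one_closed)
  show "sym (frac_rel S T)"
    by (auto simp: sym_def frac_rel_def) metis
  show "trans (frac_rel S T)"
  proof (rule transI, clarify)
    fix x s y t z r
    assume "((x, s), (y, t)) \<in> frac_rel S T" "((y, t), (z, r)) \<in> frac_rel S T"
    then obtain u v where c: "x \<in> carrier S" "y \<in> carrier S" "z \<in> carrier S"
      "s \<in> T" "t \<in> T" "r \<in> T" "u \<in> T" "v \<in> T"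
      and u: "u \<otimes> (x \<otimes> t) = u \<otimes> (y \<otimes> s)" and v: "v \<otimes> (y \<otimes> r) = v \<otimes> (z \<otimes> t)"
      by (auto simp: frac_rel_def)
    have "(u \<otimes> v \<otimes> t) \<otimes> (x \<otimes> r) = (v \<otimes> r) \<otimes> (u \<otimes> (x \<otimes> t))"
      using c by (simp add: m_ac)
    also have "\<dots> = (u \<otimes> s) \<otimes> (v \<otimes> (y \<otimes> r))"
      unfolding u using c by (simp add: m_ac)
    also have "\<dots> = (u \<otimes> v \<otimes> t) \<otimes> (z \<otimes> s)"
      unfolding v using c by (simp add: m_ac)
    finally show "((x, s), (z, r)) \<in> frac_rel S T"
      using c by (auto simp: frac_rel_def intro!: bexI[of _ "u \<otimes> v \<otimes> t"])
  qed
qed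

lemma frac_eq_iff:
  assumes "x \<in> carrier S" "s \<in> T" "y \<in> carrier S" "t \<in> T"
  shows "frac S T x s = frac S T y t \<longleftrightarrow> (\<exists>u\<in>T. u \<otimes> (x \<otimes> t) = u \<otimes> (y \<otimes> s))"
  using eq_equiv_class_iff[OF frac_rel_equiv, of "(x, s)" "(y, t)"] assms
  by (simp add: frac_def) (simp add: frac_rel_def)

lemma mult_frac:
  assumes "x \<in> carrier S" "s \<in> T" "y \<in> carrier S" "t \<in> T"
  shows "frac S T x s \<otimes>\<^bsub>localisation S T\<^esub> frac S T y t = frac S T (x \<otimes> y) (s \<otimes> t)"
proof -
  have "(\<lambda>(x, s) (y, t). frac S T (x \<otimes> y) (s \<otimes> t)) respects2 frac_rel S T"
  proof (rule congruent2I', clarify)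
    fix x s x' s' y t y' t'
    assume "((x, s), (x', s')) \<in> frac_rel S T" "((y, t), (y', t')) \<in> frac_rel S T"
    then obtain u v where c: "x \<in> carrier S" "y \<in> carrier S" "x' \<in> carrier S" "y' \<in> carrier S"
      "s \<in> T" "t \<in> T" "s' \<in> T" "t' \<in> T" "u \<in> T" "v \<in> T"
      and u: "u \<otimes> (x \<otimes> s') = u \<otimes> (x' \<otimes> s)" and v: "v \<otimes> (y \<otimes> t') = v \<otimes> (y' \<otimes> t)"
      by (auto simp: frac_rel_def)
    have "(u \<otimes> v) \<otimes> ((x \<otimes> y) \<otimes> (s' \<otimes> t')) = (u \<otimes> (x \<otimes> s')) \<otimes> (v \<otimes> (y \<otimes> t'))"
      using c by (simp add: m_ac)
    also have "\<dots> = (u \<otimes> v) \<otimes> ((x' \<otimes> y') \<otimes> (s \<otimes> t))"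
      unfolding u v using c by (simp add: m_ac)
    finally show "frac S T (x \<otimes> y) (s \<otimes> t) = frac S T (x' \<otimes> y') (s' \<otimes> t')"
      using c by (auto simp: frac_eq_iff intro!: bexI[of _ "u \<otimes> v"])
  qed
  from UN_equiv_class2[OF frac_rel_equiv frac_rel_equiv this, of "(x, s)" "(y, t)"] assms
  show ?thesis by (simp add: localisation_def frac_def case_prod_unfold)
qed

lemma add_frac:
  assumes "x \<in> carrier S" "s \<in> T" "y \<in> carrier S" "t \<in> T"
  shows "frac S T x s \<oplus>\<^bsub>localisation S T\<^esub> frac S T y t =
         frac S T ((x \<otimes> t) \<oplus> (y \<otimes> s)) (s \<otimes> t)"
proof -
  have "(\<lambda>(x, s) (y, t). frac S T ((x \<otimes> t) \<oplus> (y \<otimes> s)) (s \<otimes> t)) respects2 frac_rel S T"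
  proof (rule congruent2I', clarify)
    fix x s x' s' y t y' t'
    assume "((x, s), (x', s')) \<in> frac_rel S T" "((y, t), (y', t')) \<in> frac_rel S T"
    then obtain u v where c: "x \<in> carrier S" "y \<in> carrier S" "x' \<in> carrier S" "y' \<in> carrier S"
      "s \<in> T" "t \<in> T" "s' \<in> T" "t' \<in> T" "u \<in> T" "v \<in> T"
      and u: "u \<otimes> (x \<otimes> s') = u \<otimes> (x' \<otimes> s)" and v: "v \<otimes> (y \<otimes> t') = v \<otimes> (y' \<otimes> t)"
      by (auto simp: frac_rel_def)
    have "(u \<otimes> v) \<otimes> (((x \<otimes> t) \<oplus> (y \<otimes> s)) \<otimes> (s' \<otimes> t')) =
          (v \<otimes> t \<otimes> t') \<otimes> (u \<otimes> (x \<otimes> s')) \<oplus> (u \<otimes> s \<otimes> s') \<otimes> (v \<otimes> (y \<otimes> t'))"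
      using c by (simp add: m_ac l_distr r_distr)
    also have "\<dots> = (u \<otimes> v) \<otimes> (((x' \<otimes> t') \<oplus> (y' \<otimes> s')) \<otimes> (s \<otimes> t))"
      unfolding u v using c by (simp add: m_ac l_distr r_distr)
    finally show "frac S T ((x \<otimes> t) \<oplus> (y \<otimes> s)) (s \<otimes> t) =
                  frac S T ((x' \<otimes> t') \<oplus> (y' \<otimes> s')) (s' \<otimes> t')"
      using c by (auto simp: frac_eq_iff intro!: bexI[of _ "u \<otimes> v"])
  qed
  from UN_equiv_class2[OF frac_rel_equiv frac_rel_equiv this, of "(x, s)" "(y, t)"] assms
  show ?thesis by (simp add: localisation_def frac_def case_prod_unfold)
qed

end

end

theory Submission
  imports Defs
begin

text \<open>
  Extension \<open>I \<mapsto> T\<^sup>-\<^sup>1I\<close> is left inverse to contraction along \<open>x \<mapsto> x/1\<close>, and contraction always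
  preserves \<open>k\<close>-strong irreducibility because \<open>T\<^sup>-\<^sup>1A \<inter> T\<^sup>-\<^sup>1B = T\<^sup>-\<^sup>1(A \<inter> B)\<close>. If \<open>I\<close> is \<open>k\<close>-primary and
  avoids \<open>T\<close>, then \<open>u x \<in> I\<close> with \<open>u \<in> T\<close> forces \<open>x \<in> I\<close>, so \<open>I\<close> is the contraction of \<open>T\<^sup>-\<^sup>1I\<close>, and
  strong irreducibility carries over. It remains to see that \<open>k\<close>-strongly irreducible ideals are
  \<open>k\<close>-primary. In the von Neumann regular case they are even prime: for \<open>ab \<in> I\<close>, the residual
  ideals \<open>(I : b)\<close> and \<open>(I : (I : b))\<close> meet only in elements whose square lies in \<open>I\<close>. In a unique
  factorisation semidomain, write \<open>a = a\<^sub>1a\<^sub>2\<close> with \<open>a\<^sub>1\<close> dividing a power of \<open>b\<close> and \<open>a\<^sub>2\<close> coprime to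
  \<open>b\<close>; then \<open>\<langle>a\<^sub>1b\<rangle> \<inter> \<langle>a\<^sub>2\<rangle> = \<langle>ab\<rangle>\<close>.
\<close>

definition contracted_ideal ::
    "('a, 'm) ring_scheme \<Rightarrow> 'a set \<Rightarrow> ('a \<times> 'a) set set \<Rightarrow> 'a set" where
  "contracted_ideal S T J = {x \<in> carrier S. frac S T x \<one>\<^bsub>S\<^esub> \<in> J}"

subsection \<open>Extension and contraction\<close>

lemma k_idealD:
  assumes "k_ideal S I"
  shows "x \<in> I \<Longrightarrow> x \<in> carrier S"
    and "I \<noteq> {}"
    and "\<lbrakk>x \<in> I; y \<in> I\<rbrakk> \<Longrightarrow> x \<oplus>\<^bsub>S\<^esub> y \<in> I"
    and "\<lbrakk>r \<in> carrier S; x \<in> I\<rbrakk> \<Longrightarrow> r \<otimes>\<^bsub>S\<^esub> x \<in> I"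
    and "\<lbrakk>x \<in> carrier S; y \<in> carrier S; x \<oplus>\<^bsub>S\<^esub> y \<in> I; y \<in> I\<rbrakk> \<Longrightarrow> x \<in> I"
proof -
  have I: "I \<subseteq> carrier S" "I \<noteq> {}" "\<forall>x\<in>I. \<forall>y\<in>I. x \<oplus>\<^bsub>S\<^esub> y \<in> I"
    "\<forall>r\<in>carrier S. \<forall>x\<in>I. r \<otimes>\<^bsub>S\<^esub> x \<in> I"
    and k: "\<forall>x\<in>carrier S. \<forall>y\<in>carrier S. x \<oplus>\<^bsub>S\<^esub> y \<in> I \<and> y \<in> I \<longrightarrow> x \<in> I"
    using assms unfolding k_ideal_def semiring_ideal_def by - (elim conjE, assumption)+
  show "x \<in> I \<Longrightarrow> x \<in> carrier S" "I \<noteq> {}"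
    "\<lbrakk>x \<in> I; y \<in> I\<rbrakk> \<Longrightarrow> x \<oplus>\<^bsub>S\<^esub> y \<in> I"
    "\<lbrakk>r \<in> carrier S; x \<in> I\<rbrakk> \<Longrightarrow> r \<otimes>\<^bsub>S\<^esub> x \<in> I"
    using I by auto
  show "\<lbrakk>x \<in> carrier S; y \<in> carrier S; x \<oplus>\<^bsub>S\<^esub> y \<in> I; y \<in> I\<rbrakk> \<Longrightarrow> x \<in> I"
    using k[rule_format, of x y] by simp
qed

lemma k_idealI:
  assumes "I \<subseteq> carrier S" "I \<noteq> {}"
    and "\<And>x y. \<lbrakk>x \<in> I; y \<in> I\<rbrakk> \<Longrightarrow> x \<oplus>\<^bsub>S\<^esub> y \<in> I"
    and "\<And>r x. \<lbrakk>r \<in> carrier S; x \<in> I\<rbrakk> \<Longrightarrow> r \<otimes>\<^bsub>S\<^esub> x \<in> I"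
    and "\<And>x y. \<lbrakk>x \<in> carrier S; y \<in> carrier S; x \<oplus>\<^bsub>S\<^esub> y \<in> I; y \<in> I\<rbrakk> \<Longrightarrow> x \<in> I"
  shows "k_ideal S I"
  unfolding k_ideal_def semiring_ideal_def
  by (intro conjI ballI impI; (elim conjE)?; fact assms | rule assms; assumption)

lemma k_strongly_irreducibleD:
  assumes "k_strongly_irreducible S I"
  shows "k_ideal S I"
    and "\<lbrakk>k_ideal S A; k_ideal S B; A \<inter> B \<subseteq> I\<rbrakk> \<Longrightarrow> A \<subseteq> I \<or> B \<subseteq> I"
  using assms unfolding k_strongly_irreducible_def by blast+

lemma (in comm_semiring_one) k_ideal_zero:
  assumes "k_ideal S I" shows "\<zero> \<in> I"
proof -
  obtain x where "x \<in> I" using k_idealD(2)[OF assms] by blast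
  then show ?thesis
    using k_idealD(1)[OF assms] k_idealD(4)[OF assms zero_closed] by fastforce
qed

context localised_semiring
begin

section \<open>Extension of ideals to the localisation\<close>

lemma carrier_localisation:
  "carrier (localisation S T) = {frac S T x s | x s. x \<in> carrier S \<and> s \<in> T}"
  by (simp add: localisation_def)

lemma frac_in_carrier [simp]:
  "\<lbrakk>x \<in> carrier S; s \<in> T\<rbrakk> \<Longrightarrow> frac S T x s \<in> carrier (localisation S T)"
  by (auto simp: carrier_localisation)

lemma frac_cancel:
  assumes "x \<in> carrier S" "s \<in> T" "u \<in> T"
  shows "frac S T (u \<otimes> x) (u \<otimes> s) = frac S T x s"
  using assms by (auto simp: frac_eq_iff m_ac intro!: bexI[of _ "\<one>"])

lemma frac_in_localised_ideal [intro]: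
  "\<lbrakk>x \<in> I; s \<in> T\<rbrakk> \<Longrightarrow> frac S T x s \<in> localised_ideal S T I"
  by (auto simp: localised_ideal_def)

text \<open>Clearing denominators in \<open>x/s = y/t\<close> with \<open>y \<in> I\<close> moves a
  \<open>T\<close>-multiple of \<open>x\<close> into \<open>I\<close>; conversely
  \<open>x/s = (u x)/(u s)\<close>. The criterion does not involve \<open>s\<close>, and it replaces
  reasoning about representatives from here on.\<close>

lemma frac_mem_localised_ideal_iff:
  assumes I: "k_ideal S I" and "x \<in> carrier S" "s \<in> T"
  shows "frac S T x s \<in> localised_ideal S T I \<longleftrightarrow> (\<exists>u\<in>T. u \<otimes> x \<in> I)"
proof
  assume "frac S T x s \<in> localised_ideal S T I"
  then obtain y t where y: "y \<in> I" "t \<in> T" and "frac S T x s = frac S T y t"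
    by (auto simp: localised_ideal_def)
  moreover have yc: "y \<in> carrier S" using k_idealD(1)[OF I] y by blast
  ultimately obtain u where u: "u \<in> T" "u \<otimes> (x \<otimes> t) = u \<otimes> (y \<otimes> s)"
    using assms by (auto simp: frac_eq_iff)
  have "(u \<otimes> t) \<otimes> x = (u \<otimes> s) \<otimes> y"
    using u assms y yc by (simp add: m_ac)
  also have "\<dots> \<in> I" using u assms y by (intro k_idealD(4)[OF I]) auto
  finally show "\<exists>u\<in>T. u \<otimes> x \<in> I" using u y by blast
next
  assume "\<exists>u\<in>T. u \<otimes> x \<in> I"
  then obtain u where "u \<in> T" "u \<otimes> x \<in> I" by blast
  then show "frac S T x s \<in> localised_ideal S T I"
    using frac_cancel[of x s u] assms unfolding localised_ideal_def
    by (metis (mono_tags, lifting) mem_Collect_eq m_closed)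
qed

lemma k_ideal_localised_ideal:
  assumes I: "k_ideal S I"
  shows "k_ideal (localisation S T) (localised_ideal S T I)"
proof (rule k_idealI)
  note Ic = k_idealD(1)[OF I]
  show "localised_ideal S T I \<subseteq> carrier (localisation S T)"
    using Ic by (auto simp: localised_ideal_def)
  show "localised_ideal S T I \<noteq> {}"
    using k_idealD(2)[OF I] one_closed unfolding localised_ideal_def by blast
  fix X Y
  {
    assume "X \<in> localised_ideal S T I" "Y \<in> localised_ideal S T I"
    then obtain x s y t where "X = frac S T x s" "Y = frac S T y t"
      and c: "x \<in> I" "s \<in> T" "y \<in> I" "t \<in> T" by (auto simp: localised_ideal_def)
    moreover have "(x \<otimes> t) \<oplus> (y \<otimes> s) \<in> I"
      using k_idealD(3)[OF I k_idealD(4)[OF I, of t x] k_idealD(4)[OF I, of s y]] c Ic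
      by (simp add: m_comm)
    ultimately show "X \<oplus>\<^bsub>localisation S T\<^esub> Y \<in> localised_ideal S T I"
      using Ic by (auto simp: add_frac)
  next
    assume "X \<in> carrier (localisation S T)" "Y \<in> localised_ideal S T I"
    then obtain x s y t where "X = frac S T x s" "Y = frac S T y t"
      and "x \<in> carrier S" "s \<in> T" "y \<in> I" "t \<in> T"
      by (auto simp: localised_ideal_def carrier_localisation)
    then show "X \<otimes>\<^bsub>localisation S T\<^esub> Y \<in> localised_ideal S T I"
      using Ic k_idealD(4)[OF I] by (auto simp: mult_frac)
  next
    assume "X \<in> carrier (localisation S T)" "Y \<in> carrier (localisation S T)"
      and sum: "X \<oplus>\<^bsub>localisation S T\<^esub> Y \<in> localised_ideal S T I"
      and Y: "Y \<in> localised_ideal S T I"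
    then obtain x s y t where X: "X = frac S T x s" and Yeq: "Y = frac S T y t"
      and c: "x \<in> carrier S" "s \<in> T" "y \<in> I" "t \<in> T"
      by (auto simp: localised_ideal_def carrier_localisation)
    have yc: "y \<in> carrier S" using c Ic by blast
    have "frac S T ((x \<otimes> t) \<oplus> (y \<otimes> s)) (s \<otimes> t) \<in> localised_ideal S T I"
      using sum X Yeq c yc by (simp add: add_frac)
    then obtain u where u: "u \<in> T" "u \<otimes> ((x \<otimes> t) \<oplus> (y \<otimes> s)) \<in> I"
      using c yc by (auto simp: frac_mem_localised_ideal_iff[OF I])
    \<comment> \<open>Distributing \<open>u\<close> isolates a multiple of \<open>y\<close>, which
      is in \<open>I\<close> already, so subtractivity of \<open>I\<close> releases the multiple of
      \<open>x\<close>.\<close>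
    have "(u \<otimes> t) \<otimes> x \<oplus> (u \<otimes> s) \<otimes> y \<in> I"
      using u c yc by (simp add: r_distr m_ac)
    moreover have "(u \<otimes> s) \<otimes> y \<in> I" using u c by (intro k_idealD(4)[OF I]) auto
    ultimately have "(u \<otimes> t) \<otimes> x \<in> I"
      using u c yc by (intro k_idealD(5)[OF I, of "(u \<otimes> t) \<otimes> x" "(u \<otimes> s) \<otimes> y"]) auto
    then show "X \<in> localised_ideal S T I"
      unfolding X using u c by (auto simp: frac_mem_localised_ideal_iff[OF I])
  }
qed

section \<open>Contraction of ideals along \<open>x \<mapsto> x/1\<close>\<close>

text \<open>The fractions \<open>s/1\<close> and \<open>1/s\<close> are mutually inverse, so
  multiplying by one or the other passes between \<open>x/s\<close> and \<open>x/1\<close> inside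
  \<open>J\<close>.\<close>

lemma frac_mem_iff:
  assumes J: "k_ideal (localisation S T) J" and "x \<in> carrier S" "s \<in> T"
  shows "frac S T x s \<in> J \<longleftrightarrow> x \<in> contracted_ideal S T J"
proof
  assume "frac S T x s \<in> J"
  then have "frac S T s \<one> \<otimes>\<^bsub>localisation S T\<^esub> frac S T x s \<in> J"
    using assms by (intro k_idealD(4)[OF J]) auto
  also have "frac S T s \<one> \<otimes>\<^bsub>localisation S T\<^esub> frac S T x s = frac S T x \<one>"
    using assms frac_cancel[of x \<one> s] by (simp add: mult_frac)
  finally show "x \<in> contracted_ideal S T J" using assms by (simp add: contracted_ideal_def)
next
  assume "x \<in> contracted_ideal S T J"
  then have "frac S T \<one> s \<otimes>\<^bsub>localisation S T\<^esub> frac S T x \<one> \<in> J"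
    using assms by (intro k_idealD(4)[OF J]) (auto simp: contracted_ideal_def)
  then show "frac S T x s \<in> J" using assms by (simp add: mult_frac)
qed

lemma localised_contracted_ideal:
  assumes J: "k_ideal (localisation S T) J"
  shows "localised_ideal S T (contracted_ideal S T J) = J"
proof
  have "x \<in> contracted_ideal S T J \<Longrightarrow> x \<in> carrier S" for x
    by (simp add: contracted_ideal_def)
  then show "localised_ideal S T (contracted_ideal S T J) \<subseteq> J"
    using frac_mem_iff[OF J] by (auto simp: localised_ideal_def)
  show "J \<subseteq> localised_ideal S T (contracted_ideal S T J)"
  proof
    fix X assume "X \<in> J"
    moreover from this obtain x s where "X = frac S T x s" "x \<in> carrier S" "s \<in> T"
      using k_idealD(1)[OF J] unfolding carrier_localisation by blast
    ultimately show "X \<in> localised_ideal S T (contracted_ideal S T J)"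
      using frac_mem_iff[OF J] by (auto simp: localised_ideal_def)
  qed
qed

text \<open>The map \<open>x \<mapsto> x/1\<close> respects sums and products, and preimages along
  it inherit the closure properties of \<open>J\<close>.\<close>

lemma k_ideal_contracted_ideal:
  assumes J: "k_ideal (localisation S T) J"
  shows "k_ideal S (contracted_ideal S T J)"
proof (rule k_idealI)
  show "contracted_ideal S T J \<subseteq> carrier S" by (auto simp: contracted_ideal_def)
  show "contracted_ideal S T J \<noteq> {}"
    using localised_contracted_ideal[OF J] k_idealD(2)[OF J] by (auto simp: localised_ideal_def)
  have add: "frac S T x \<one> \<oplus>\<^bsub>localisation S T\<^esub> frac S T y \<one> = frac S T (x \<oplus> y) \<one>"
    and mult: "frac S T x \<one> \<otimes>\<^bsub>localisation S T\<^esub> frac S T y \<one> = frac S T (x \<otimes> y) \<one>"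
    if "x \<in> carrier S" "y \<in> carrier S" for x y
    using that by (simp_all add: add_frac mult_frac)
  fix x y
  show "x \<oplus> y \<in> contracted_ideal S T J"
    if "x \<in> contracted_ideal S T J" "y \<in> contracted_ideal S T J"
    using that k_idealD(3)[OF J] by (auto simp: contracted_ideal_def add[symmetric])
  show "x \<otimes> y \<in> contracted_ideal S T J"
    if "x \<in> carrier S" "y \<in> contracted_ideal S T J"
    using that k_idealD(4)[OF J] by (auto simp: contracted_ideal_def mult[symmetric])
  show "x \<in> contracted_ideal S T J"
    if "x \<in> carrier S" "y \<in> carrier S" "x \<oplus> y \<in> contracted_ideal S T J"
      "y \<in> contracted_ideal S T J"
    using that k_idealD(5)[OF J, of "frac S T x \<one>" "frac S T y \<one>"]
    by (auto simp: contracted_ideal_def add[symmetric])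
qed

lemma k_strongly_irreducible_contracted_ideal:
  assumes J: "k_strongly_irreducible (localisation S T) J"
  shows "k_strongly_irreducible S (contracted_ideal S T J)"
  unfolding k_strongly_irreducible_def
proof (intro conjI allI impI)
  note kJ = k_strongly_irreducibleD(1)[OF J]
  show "k_ideal S (contracted_ideal S T J)" by (rule k_ideal_contracted_ideal[OF kJ])
  fix A B
  assume A: "k_ideal S A" and B: "k_ideal S B" and AB: "A \<inter> B \<subseteq> contracted_ideal S T J"
  have "localised_ideal S T A \<inter> localised_ideal S T B \<subseteq> J"
  proof
    fix X assume X: "X \<in> localised_ideal S T A \<inter> localised_ideal S T B"
    then obtain x s where xs: "X = frac S T x s" "x \<in> carrier S" "s \<in> T"
      using k_idealD(1)[OF A] by (auto simp: localised_ideal_def)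
    then obtain u v where uv: "u \<in> T" "u \<otimes> x \<in> A" "v \<in> T" "v \<otimes> x \<in> B"
      using X frac_mem_localised_ideal_iff[OF A xs(2,3)] frac_mem_localised_ideal_iff[OF B xs(2,3)]
      by auto
    \<comment> \<open>The product \<open>u \<otimes> v\<close> is a common multiplier that works for
      \<open>A\<close> and for \<open>B\<close>, which puts one numerator of \<open>X\<close> into
      \<open>A \<inter> B\<close>.\<close>
    have "(u \<otimes> v) \<otimes> x \<in> A" "(u \<otimes> v) \<otimes> x \<in> B"
      using k_idealD(4)[OF A, of v "u \<otimes> x"] k_idealD(4)[OF B, of u "v \<otimes> x"] uv xs
      by (simp_all add: m_ac)
    then have "(u \<otimes> v) \<otimes> x \<in> contracted_ideal S T J" using AB by blast
    then have "frac S T ((u \<otimes> v) \<otimes> x) ((u \<otimes> v) \<otimes> s) \<in> J"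
      using uv xs by (subst frac_mem_iff[OF kJ]) auto
    then show "X \<in> J" using uv xs frac_cancel[of x s "u \<otimes> v"] by simp
  qed
  moreover have "A' \<subseteq> contracted_ideal S T J"
    if "k_ideal S A'" "localised_ideal S T A' \<subseteq> J" for A'
  proof
    fix x assume x: "x \<in> A'"
    then have "frac S T x \<one> \<in> J" using that one_closed by blast
    then show "x \<in> contracted_ideal S T J"
      using x k_idealD(1)[OF that(1)] by (simp add: contracted_ideal_def)
  qed
  ultimately show "A \<subseteq> contracted_ideal S T J \<or> B \<subseteq> contracted_ideal S T J"
    using k_strongly_irreducibleD(2)[OF J] k_ideal_localised_ideal A B by meson
qed

text \<open>An element \<open>s\<close> of \<open>T\<close> in the contraction would give a unit
  \<open>s/1\<close> in \<open>J\<close>; explicitly, every \<open>x/t = (s x)/(s t)\<close> would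
  then lie in \<open>J\<close>.\<close>

lemma contracted_ideal_disjoint:
  assumes J: "k_ideal (localisation S T) J" and "J \<noteq> carrier (localisation S T)"
  shows "contracted_ideal S T J \<inter> T = {}"
proof (rule ccontr)
  note kc = k_ideal_contracted_ideal[OF J]
  assume "contracted_ideal S T J \<inter> T \<noteq> {}"
  then obtain s where s: "s \<in> contracted_ideal S T J" "s \<in> T" by blast
  have "frac S T x t \<in> J" if "x \<in> carrier S" "t \<in> T" for x t
  proof -
    have "s \<otimes> x \<in> contracted_ideal S T J"
      using k_idealD(4)[OF kc that(1) s(1)] that s by (simp add: m_comm)
    then have "frac S T (s \<otimes> x) (s \<otimes> t) \<in> J"
      using that s by (subst frac_mem_iff[OF J]) auto
    then show ?thesis using that s by (simp add: frac_cancel)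
  qed
  then show False using assms k_idealD(1)[OF J] by (auto simp: carrier_localisation)
qed

section \<open>Extension of \<open>k\<close>-primary ideals that avoid \<open>T\<close>\<close>

lemma nat_pow_in_T: "u \<in> T \<Longrightarrow> u [^] (n::nat) \<in> T"
  by (induction n) auto

lemma k_primary_cancel:
  assumes I: "k_primary S I" "I \<inter> T = {}" and "u \<in> T" "x \<in> carrier S" "u \<otimes> x \<in> I"
  shows "x \<in> I"
proof (rule ccontr)
  assume "x \<notin> I"
  \<comment> \<open>The factors are swapped because \<open>k_primary\<close> yields a power of the
    second factor. That power of \<open>u\<close> lies in \<open>T\<close>, which \<open>I\<close>
    avoids.\<close>
  moreover have "x \<otimes> u \<in> I" using assms by (simp add: m_comm)
  ultimately obtain n :: nat where "u [^] n \<in> I"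
    using assms(1,3,4) unfolding k_primary_def by fastforce
  then show False using nat_pow_in_T assms by blast
qed

text \<open>For these ideals the multiplier \<open>u\<close> in the general membership criterion can
  be cancelled, so numerators alone decide membership.\<close>

lemma frac_mem_localised_k_primary_iff:
  assumes I: "k_primary S I" "I \<inter> T = {}" and "x \<in> carrier S" "s \<in> T"
  shows "frac S T x s \<in> localised_ideal S T I \<longleftrightarrow> x \<in> I"
proof -
  have "k_ideal S I" using I by (simp add: k_primary_def)
  moreover have "\<one> \<otimes> x = x" using assms by simp
  ultimately show ?thesis
    using k_primary_cancel[OF I] assms frac_mem_localised_ideal_iff[of I x s] by (metis one_closed)
qed

lemma contracted_localised_ideal:
  assumes I: "k_primary S I" "I \<inter> T = {}"
  shows "contracted_ideal S T (localised_ideal S T I) = I"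
proof -
  have "k_ideal S I" using I by (simp add: k_primary_def)
  then show ?thesis
    using k_idealD(1) frac_mem_localised_k_primary_iff[OF I] by (fastforce simp: contracted_ideal_def)
qed

lemma localised_ideal_proper:
  assumes I: "k_primary S I" "I \<inter> T = {}"
  shows "localised_ideal S T I \<noteq> carrier (localisation S T)"
proof
  assume "localised_ideal S T I = carrier (localisation S T)"
  then have "frac S T \<one> \<one> \<in> localised_ideal S T I" by simp
  then show False using frac_mem_localised_k_primary_iff[OF I, of \<one> \<one>] I by auto
qed

text \<open>The test ideals are contracted to \<open>S\<close>, compared with \<open>I\<close>
  there, and extended back; this returns to the original ideals because extension undoes
  contraction.\<close>

lemma k_strongly_irreducible_localised_ideal:
  assumes I: "k_strongly_irreducible S I" "k_primary S I" "I \<inter> T = {}"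
  shows "k_strongly_irreducible (localisation S T) (localised_ideal S T I)"
  unfolding k_strongly_irreducible_def
proof (intro conjI allI impI)
  show "k_ideal (localisation S T) (localised_ideal S T I)"
    by (rule k_ideal_localised_ideal[OF k_strongly_irreducibleD(1)[OF I(1)]])
  fix A B
  assume A: "k_ideal (localisation S T) A" and B: "k_ideal (localisation S T) B"
    and AB: "A \<inter> B \<subseteq> localised_ideal S T I"
  have "contracted_ideal S T A \<inter> contracted_ideal S T B \<subseteq>
      contracted_ideal S T (localised_ideal S T I)"
    using AB by (auto simp: contracted_ideal_def)
  also have "\<dots> = I" by (rule contracted_localised_ideal[OF I(2,3)])
  finally have "contracted_ideal S T A \<subseteq> I \<or> contracted_ideal S T B \<subseteq> I"
    by (rule k_strongly_irreducibleD(2)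
        [OF I(1) k_ideal_contracted_ideal[OF A] k_ideal_contracted_ideal[OF B]])
  moreover have "C \<subseteq> localised_ideal S T I"
    if "k_ideal (localisation S T) C" "contracted_ideal S T C \<subseteq> I" for C
  proof -
    have "localised_ideal S T (contracted_ideal S T C) \<subseteq> localised_ideal S T I"
      using that(2) by (auto simp: localised_ideal_def)
    then show ?thesis using localised_contracted_ideal[OF that(1)] by simp
  qed
  ultimately show "A \<subseteq> localised_ideal S T I \<or> B \<subseteq> localised_ideal S T I"
    using A B by blast
qed

lemma frac_nat_pow:
  fixes n :: nat
  assumes "x \<in> carrier S" "s \<in> T"
  shows "frac S T x s [^]\<^bsub>localisation S T\<^esub> n = frac S T (x [^] n) (s [^] n)"
proof (induction n)
  case 0
  then show ?case by (simp add: localisation_def)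
next
  case (Suc n)
  then show ?case using assms nat_pow_in_T by (simp add: mult_frac)
qed

lemma k_primary_localised_ideal:
  assumes I: "k_primary S I" "I \<inter> T = {}"
  shows "k_primary (localisation S T) (localised_ideal S T I)"
  unfolding k_primary_def
proof (intro conjI ballI impI)
  show "k_ideal (localisation S T) (localised_ideal S T I)"
    using I by (intro k_ideal_localised_ideal) (simp add: k_primary_def)
  note mem_iff = frac_mem_localised_k_primary_iff[OF I]
  fix X Y
  assume "X \<in> carrier (localisation S T)" "Y \<in> carrier (localisation S T)"
    and XY: "X \<otimes>\<^bsub>localisation S T\<^esub> Y \<in> localised_ideal S T I" "X \<notin> localised_ideal S T I"
  then obtain x s y t where eq: "X = frac S T x s" "Y = frac S T y t"
    and c: "x \<in> carrier S" "s \<in> T" "y \<in> carrier S" "t \<in> T"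
    by (auto simp: carrier_localisation)
  have "x \<otimes> y \<in> I" "x \<notin> I" using XY eq c by (simp_all add: mult_frac mem_iff)
  then obtain n :: nat where "n > 0" "y [^] n \<in> I"
    using I(1) c unfolding k_primary_def by blast
  then show "\<exists>n::nat>0. Y [^]\<^bsub>localisation S T\<^esub> n \<in> localised_ideal S T I"
    using c nat_pow_in_T by (auto simp: eq frac_nat_pow mem_iff intro!: exI[of _ n])
qed

text \<open>The hypothesis \<open>primary\<close> isolates what the two classes of semirings in the
  theorem have to supply. Contraction is the inverse map, and properness upstairs corresponds to
  avoiding \<open>T\<close> downstairs.\<close>

lemma bij_betw_localised_ideal:
  assumes primary: "\<And>I. k_strongly_irreducible S I \<Longrightarrow> k_primary S I"
  shows "bij_betw (localised_ideal S T)
    {I. k_strongly_irreducible S I \<and> I \<inter> T = {}}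
    {J. k_strongly_irreducible (localisation S T) J \<and> J \<noteq> carrier (localisation S T)}"
proof (rule bij_betw_byWitness[where f' = "contracted_ideal S T"])
  show "\<forall>I\<in>{I. k_strongly_irreducible S I \<and> I \<inter> T = {}}.
      contracted_ideal S T (localised_ideal S T I) = I"
    using primary contracted_localised_ideal by blast
  show "\<forall>J\<in>{J. k_strongly_irreducible (localisation S T) J \<and> J \<noteq> carrier (localisation S T)}.
      localised_ideal S T (contracted_ideal S T J) = J"
    using localised_contracted_ideal k_strongly_irreducibleD(1) by blast
  show "localised_ideal S T ` {I. k_strongly_irreducible S I \<and> I \<inter> T = {}} \<subseteq>
      {J. k_strongly_irreducible (localisation S T) J \<and> J \<noteq> carrier (localisation S T)}"
    using primary k_strongly_irreducible_localised_ideal localised_ideal_proper by blast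
  show "contracted_ideal S T `
      {J. k_strongly_irreducible (localisation S T) J \<and> J \<noteq> carrier (localisation S T)} \<subseteq>
      {I. k_strongly_irreducible S I \<and> I \<inter> T = {}}"
    using k_strongly_irreducible_contracted_ideal contracted_ideal_disjoint
      k_strongly_irreducibleD(1) by blast
qed

end

subsection \<open>Strongly irreducible ideals that are primary\<close>

context comm_semiring_one
begin

section \<open>Residual ideals and the von Neumann regular case\<close>

text \<open>This is the residual \<open>(I : C)\<close>. An arbitrary subset \<open>C\<close> covers
  both \<open>(I : b)\<close>, with \<open>C = {b}\<close>, and the iterated residual
  \<open>(I : (I : b))\<close>.\<close>

lemma k_ideal_residual:
  assumes I: "k_ideal S I" and C: "C \<subseteq> carrier S"
  shows "k_ideal S {x \<in> carrier S. \<forall>c\<in>C. x \<otimes> c \<in> I}" (is "k_ideal S ?R")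
proof (rule k_idealI)
  have cc: "c \<in> carrier S" if "c \<in> C" for c using that C by blast
  show "?R \<subseteq> carrier S" by blast
  have "\<zero> \<in> ?R" using k_ideal_zero[OF I] cc by simp
  then show "?R \<noteq> {}" by blast
  fix x y
  show "x \<oplus> y \<in> ?R" if "x \<in> ?R" "y \<in> ?R"
    using that k_idealD(3)[OF I] cc by (simp add: l_distr)
  show "x \<otimes> y \<in> ?R" if "x \<in> carrier S" "y \<in> ?R"
    using that k_idealD(4)[OF I] cc by (simp add: m_assoc)
  show "x \<in> ?R" if "x \<in> carrier S" "y \<in> carrier S" "x \<oplus> y \<in> ?R" "y \<in> ?R"
  proof -
    have "x \<otimes> c \<in> I" if "c \<in> C" for c
      using k_idealD(5)[OF I, of "x \<otimes> c" "y \<otimes> c"] that cc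
        \<open>x \<in> carrier S\<close> \<open>x \<oplus> y \<in> ?R\<close> \<open>y \<in> ?R\<close> by (simp add: l_distr)
    then show ?thesis using \<open>x \<in> carrier S\<close> by simp
  qed
qed

lemma von_neumann_regular_k_primary:
  assumes vnr: "von_neumann_regular S" and I: "k_strongly_irreducible S I"
  shows "k_primary S I"
  unfolding k_primary_def
proof (intro conjI ballI impI)
  show kI: "k_ideal S I" by (rule k_strongly_irreducibleD(1)[OF I])
  fix a b
  assume a: "a \<in> carrier S" and b: "b \<in> carrier S" and ab: "a \<otimes> b \<in> I" "a \<notin> I"
  define A where "A = {x \<in> carrier S. \<forall>c\<in>{b}. x \<otimes> c \<in> I}"
  define B where "B = {x \<in> carrier S. \<forall>c\<in>A. x \<otimes> c \<in> I}"
  have Ac: "A \<subseteq> carrier S" by (auto simp: A_def)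
  have kA: "k_ideal S A" unfolding A_def using b by (intro k_ideal_residual[OF kI]) auto
  have kB: "k_ideal S B" unfolding B_def by (rule k_ideal_residual[OF kI Ac])
  have "A \<inter> B \<subseteq> I"
  proof
    fix z assume z: "z \<in> A \<inter> B"
    \<comment> \<open>As \<open>z \<in> B\<close> multiplies all of \<open>A\<close> into
      \<open>I\<close>, it multiplies itself, an element of \<open>A\<close>, into
      \<open>I\<close>.\<close>
    then have zz: "z \<in> carrier S" "z \<otimes> z \<in> I" by (auto simp: B_def)
    then obtain x where x: "x \<in> carrier S" "z = (z \<otimes> z) \<otimes> x"
      using vnr by (auto simp: von_neumann_regular_def)
    then have "z = x \<otimes> (z \<otimes> z)" using zz by (simp add: m_comm)
    then show "z \<in> I" using k_idealD(4)[OF kI x(1) zz(2)] by simp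
  qed
  then have "A \<subseteq> I \<or> B \<subseteq> I" by (rule k_strongly_irreducibleD(2)[OF I kA kB])
  moreover have "a \<in> A" using a ab by (simp add: A_def)
  moreover have "b \<in> B" using b Ac by (auto simp: A_def B_def m_comm)
  ultimately have "b \<in> I" using ab by blast
  then show "\<exists>n::nat>0. b [^] n \<in> I" using b by (intro exI[of _ 1]) simp
qed

section \<open>Principal ideals, divisibility and the unique factorisation case\<close>

lemma semiring_ideal_cgenideal:
  assumes "a \<in> carrier S"
  shows "semiring_ideal S (PIdl a)"
  unfolding semiring_ideal_def
proof (intro conjI ballI)
  show "PIdl a \<subseteq> carrier S" "PIdl a \<noteq> {}" using assms by (auto simp: cgenideal_def)
  fix x y assume "x \<in> PIdl a" "y \<in> PIdl a"
  then obtain u v where "u \<in> carrier S" "v \<in> carrier S" "x = u \<otimes> a" "y = v \<otimes> a"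
    by (auto simp: cgenideal_def)
  then show "x \<oplus> y \<in> PIdl a"
    using assms by (auto simp: cgenideal_def l_distr[symmetric] intro!: exI[of _ "u \<oplus> v"])
next
  fix r x assume "r \<in> carrier S" "x \<in> PIdl a"
  then obtain u where "r \<in> carrier S" "u \<in> carrier S" "x = u \<otimes> a"
    by (auto simp: cgenideal_def)
  then show "r \<otimes> x \<in> PIdl a"
    using assms by (auto simp: cgenideal_def m_assoc[symmetric] intro!: exI[of _ "r \<otimes> u"])
qed

lemma mem_cgenideal_iff:
  assumes "a \<in> carrier S"
  shows "x \<in> PIdl a \<longleftrightarrow> a divides x"
  using assms by (auto simp: cgenideal_def factor_def m_comm)

lemma semiring_prime_divides_mult:
  assumes "semiring_prime S p" "a \<in> carrier S" "b \<in> carrier S" "p divides a \<otimes> b"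
  shows "p divides a \<or> p divides b"
  using assms by (auto simp: semiring_prime_def semiring_prime_ideal_def mem_cgenideal_iff)

text \<open>Each prime factor that divides \<open>b\<close> goes into \<open>a1\<close>, at the cost
  of one more power of \<open>b\<close>; every other one goes into \<open>a2\<close>. Coprimality of
  \<open>a2\<close> and \<open>b\<close> is phrased as cancelling \<open>b\<close> under
  divisibility by \<open>a2\<close>, the form that the induction and the later argument use
  directly.\<close>

lemma coprime_part_decomposition:
  assumes sd: "semidomain S"
    and fs: "\<forall>p\<in>set fs. p \<in> carrier S \<and> p \<noteq> \<zero> \<and> semiring_prime S p"
    and b: "b \<in> carrier S"
  shows "\<exists>(m::nat) a1 a2. a1 \<in> carrier S \<and> a2 \<in> carrier S \<and>
    foldr (\<otimes>) fs \<one> = a1 \<otimes> a2 \<and> a1 divides b [^] m \<and>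
    (\<forall>v\<in>carrier S. a2 divides b \<otimes> v \<longrightarrow> a2 divides v)"
  using fs
proof (induction fs)
  case Nil
  show ?case by (rule exI[of _ "0::nat"], rule exI[of _ \<one>], rule exI[of _ \<one>]) (auto simp: factor_def)
next
  case (Cons p fs)
  have cancel: "x = y" if "z \<in> carrier S" "x \<in> carrier S" "y \<in> carrier S"
    "z \<otimes> x = z \<otimes> y" "z \<noteq> \<zero>" for x y z
    using sd that unfolding semidomain_def by blast
  from Cons.prems have p: "p \<in> carrier S" "p \<noteq> \<zero>" "semiring_prime S p" by auto
  from Cons obtain m :: nat and a1 a2 where a: "a1 \<in> carrier S" "a2 \<in> carrier S"
    "foldr (\<otimes>) fs \<one> = a1 \<otimes> a2" "a1 divides b [^] m"
    and cop: "\<And>v. v \<in> carrier S \<Longrightarrow> a2 divides b \<otimes> v \<Longrightarrow> a2 divides v"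
    by auto
  show ?case
  proof (cases "p divides b")
    case True
    then obtain c where c: "c \<in> carrier S" "b = p \<otimes> c" by (auto simp: factor_def)
    obtain d where d: "d \<in> carrier S" "b [^] m = a1 \<otimes> d" using a by (auto simp: factor_def)
    have "b [^] Suc m = (a1 \<otimes> d) \<otimes> (p \<otimes> c)" using c d by simp
    also have "\<dots> = (p \<otimes> a1) \<otimes> (d \<otimes> c)" using a c d p by (simp add: m_ac)
    finally have "(p \<otimes> a1) divides b [^] Suc m"
      unfolding factor_def using c d by (intro bexI[of _ "d \<otimes> c"]) auto
    moreover have "foldr (\<otimes>) (p # fs) \<one> = (p \<otimes> a1) \<otimes> a2"
      using a p by (simp add: m_assoc)
    ultimately show ?thesis
      using a p cop
      by (intro exI[of _ "Suc m"] exI[of _ "p \<otimes> a1"] exI[of _ a2] conjI ballI impI) simp_all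
  next
    case False
    have "(p \<otimes> a2) divides v" if v: "v \<in> carrier S" and dv: "(p \<otimes> a2) divides b \<otimes> v" for v
    proof -
      obtain c where c: "c \<in> carrier S" "b \<otimes> v = p \<otimes> a2 \<otimes> c"
        using dv by (auto simp: factor_def)
      then have "p divides b \<otimes> v"
        using p a unfolding factor_def by (intro bexI[of _ "a2 \<otimes> c"]) (auto simp: m_assoc)
      then have "p divides v"
        using semiring_prime_divides_mult[OF p(3) b v] False by blast
      then obtain w where w: "w \<in> carrier S" "v = p \<otimes> w" by (auto simp: factor_def)
      \<comment> \<open>Cancelling the non-zero \<open>p\<close> reduces divisibility by
        \<open>p \<otimes> a2\<close> to divisibility by \<open>a2\<close>, where the induction
        hypothesis applies.\<close>
      have "p \<otimes> (b \<otimes> w) = p \<otimes> (a2 \<otimes> c)" using c w p a b by (simp add: m_ac)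
      then have "b \<otimes> w = a2 \<otimes> c" using cancel[of p "b \<otimes> w" "a2 \<otimes> c"] p a b c w by simp
      then have "a2 divides w" using cop w c by (auto simp: factor_def)
      then show ?thesis using w p a by (auto simp: factor_def m_assoc)
    qed
    moreover have "foldr (\<otimes>) (p # fs) \<one> = a1 \<otimes> (p \<otimes> a2)"
      using a p by (simp add: m_ac)
    ultimately show ?thesis
      using a p
      by (intro exI[of _ m] exI[of _ a1] exI[of _ "p \<otimes> a2"] conjI ballI impI) simp_all
  qed
qed

text \<open>Coprimality is applied once for each factor \<open>b\<close> of the power.\<close>

lemma divides_pow_mult_cancel:
  fixes n :: nat
  assumes cop: "\<forall>v\<in>carrier S. a divides b \<otimes> v \<longrightarrow> a divides v"
    and "b \<in> carrier S" "u \<in> carrier S" "a divides b [^] n \<otimes> u"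
  shows "a divides u"
  using assms(3,4)
proof (induction n arbitrary: u)
  case (Suc n)
  then have "a divides b [^] n \<otimes> (b \<otimes> u)" using assms(2) by (simp add: m_assoc)
  then have "a divides b \<otimes> u" using Suc assms(2) by simp
  then show ?case using cop Suc.prems(1) by simp
qed (use assms in simp)

text \<open>Subtractivity makes principal ideals admissible as test ideals for strong
  irreducibility. Testing with \<open>\<langle>a1 b\<rangle>\<close> and
  \<open>\<langle>a2\<rangle>\<close> forces \<open>a1 b\<close> into \<open>I\<close>, and
  \<open>a1 b\<close> divides a power of \<open>b\<close>.\<close>

lemma subtractive_ufsd_k_primary:
  assumes sub: "subtractive S" and uf: "unique_factorisation_semidomain S"
    and I: "k_strongly_irreducible S I"
  shows "k_primary S I"
  unfolding k_primary_def
proof (intro conjI ballI impI)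
  show kI: "k_ideal S I" by (rule k_strongly_irreducibleD(1)[OF I])
  fix a b
  assume a: "a \<in> carrier S" and b: "b \<in> carrier S" and ab: "a \<otimes> b \<in> I" "a \<notin> I"
  have divI: "y \<in> I" if x: "x \<in> I" and xy: "x divides y" for x y
  proof -
    obtain c where "c \<in> carrier S" "y = x \<otimes> c" using xy by (auto simp: factor_def)
    then show ?thesis
      using k_idealD(4)[OF kI, of c x] k_idealD(1)[OF kI x] x by (simp add: m_comm)
  qed
  have kP: "k_ideal S (PIdl c)" if "c \<in> carrier S" for c
    using sub semiring_ideal_cgenideal[OF that] by (simp add: subtractive_def)
  show "\<exists>n::nat>0. b [^] n \<in> I"
  \<comment> \<open>Factorisations are available only for non-zero non-units; for a unit
    \<open>a\<close>, already \<open>b \<in> I\<close>.\<close>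
  proof (cases "a \<in> Units S")
    case True
    then have "inv a \<otimes> (a \<otimes> b) \<in> I" using ab k_idealD(4)[OF kI] by blast
    moreover have "inv a \<otimes> (a \<otimes> b) = b"
      using True a b by (simp add: m_assoc[symmetric])
    ultimately show ?thesis using b by (intro exI[of _ 1]) simp
  next
    case False
    moreover have "a \<noteq> \<zero>" using ab k_ideal_zero[OF kI] by auto
    ultimately obtain fs where fs: "irreducible_factorisation S fs a"
      using uf a unfolding unique_factorisation_semidomain_def by blast
    have "\<forall>p\<in>set fs. p \<in> carrier S \<and> p \<noteq> \<zero> \<and> semiring_prime S p"
      using fs uf
      by (auto simp: irreducible_factorisation_def unique_factorisation_semidomain_def
          semiring_irreducible_def)
    moreover have "semidomain S" using uf by (simp add: unique_factorisation_semidomain_def)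
    ultimately obtain m :: nat and a1 a2 where a12: "a1 \<in> carrier S" "a2 \<in> carrier S"
      "a = a1 \<otimes> a2" "a1 divides b [^] m"
      and cop: "\<forall>v\<in>carrier S. a2 divides b \<otimes> v \<longrightarrow> a2 divides v"
      using coprime_part_decomposition[of fs b] fs b unfolding irreducible_factorisation_def
      by blast
    from a12 obtain d where d: "d \<in> carrier S" "b [^] m = a1 \<otimes> d" by (auto simp: factor_def)
    have "PIdl (a1 \<otimes> b) \<inter> PIdl a2 \<subseteq> I"
    proof
      fix z assume "z \<in> PIdl (a1 \<otimes> b) \<inter> PIdl a2"
      then have "a1 \<otimes> b divides z" and z2: "a2 divides z"
        using a12 b by (auto simp: mem_cgenideal_iff)
      then obtain u where u: "u \<in> carrier S" "z = a1 \<otimes> b \<otimes> u" by (auto simp: factor_def)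
      \<comment> \<open>Multiplying \<open>z = a1 b u\<close> by the cofactor \<open>d\<close> of
        \<open>a1\<close> in \<open>b [^] m\<close> completes \<open>a1 b\<close> to a pure power of
        \<open>b\<close>, which coprimality with \<open>a2\<close> can strip off.\<close>
      have "b [^] Suc m \<otimes> u = z \<otimes> d" using u d a12 b by (simp add: m_ac)
      moreover have "a2 divides z \<otimes> d" using z2 a12 d by (auto simp: factor_def m_assoc)
      ultimately have "a2 divides b [^] Suc m \<otimes> u" by simp
      then have "a2 divides u" by (rule divides_pow_mult_cancel[OF cop b u(1)])
      then obtain w where w: "w \<in> carrier S" "u = a2 \<otimes> w" by (auto simp: factor_def)
      have "z = (a \<otimes> b) \<otimes> w" using u w a12 b by (simp add: m_ac)
      then show "z \<in> I" using divI[OF ab(1)] w by (auto simp: factor_def)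
    qed
    then have "PIdl (a1 \<otimes> b) \<subseteq> I \<or> PIdl a2 \<subseteq> I"
      using a12 b by (intro k_strongly_irreducibleD(2)[OF I] kP) auto
    moreover have "a1 \<otimes> b \<in> PIdl (a1 \<otimes> b)" "a2 \<in> PIdl a2"
      using a12 b by (auto simp: mem_cgenideal_iff)
    moreover have "a2 divides a" using a12 by (auto simp: factor_def m_comm)
    \<comment> \<open>The alternative \<open>\<langle>a2\<rangle> \<subseteq> I\<close> would put
      \<open>a\<close>, a multiple of \<open>a2\<close>, into \<open>I\<close>.\<close>
    ultimately have "a1 \<otimes> b \<in> I" using divI ab(2) by blast
    \<comment> \<open>The extra factor \<open>b\<close> raises the exponent to \<open>Suc m\<close>,
      which is positive as \<open>k_primary\<close> demands, even when \<open>m = 0\<close>.\<close>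
    moreover have "b [^] Suc m = (a1 \<otimes> b) \<otimes> d" using d a12 b by (simp add: m_ac)
    then have "a1 \<otimes> b divides b [^] Suc m" using d by (auto simp: factor_def)
    ultimately show ?thesis using divI by blast
  qed
qed

end

text \<open>The correspondence is the extension map itself. The whole localisation counts as
  \<open>k\<close>-strongly irreducible but is not the extension of a \<open>k\<close>-ideal
  avoiding \<open>T\<close>, hence the properness condition on \<open>J\<close>. If
  \<open>\<zero> \<in> T\<close>, both sides of the bijection are empty.\<close>

theorem corollary6p7:
  fixes S :: "('a, 'm) ring_scheme" and T :: "'a set"
  assumes "comm_semiring_one S"
    and "submonoid T S"
  shows "(\<forall>I. k_strongly_irreducible S I \<longrightarrow> k_primary S I \<longrightarrow> I \<inter> T = {} \<longrightarrow>
            k_strongly_irreducible (localisation S T) (localised_ideal S T I) \<and>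
            k_primary (localisation S T) (localised_ideal S T I)) \<and>
         ((subtractive S \<and> unique_factorisation_semidomain S) \<or> von_neumann_regular S \<longrightarrow>
            bij_betw (localised_ideal S T)
              {I. k_strongly_irreducible S I \<and> I \<inter> T = {}}
              {J. k_strongly_irreducible (localisation S T) J \<and> J \<noteq> carrier (localisation S T)})"
proof -
  interpret localised_semiring S T
    using assms by (rule localised_semiring.intro)
  show ?thesis
    using k_strongly_irreducible_localised_ideal k_primary_localised_ideal
      bij_betw_localised_ideal subtractive_ufsd_k_primary von_neumann_regular_k_primary
    by blast
qed

end
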